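(* Let $\mathbf{k}$ be a commutative ring, $q\in\mathbf{k}$ and $r:=q+1$. Let $\alpha=(\alpha_1,\alpha_2,\ldots,\alpha_\ell)\in\mathrm{Comp}$. Then $$\eta_\alpha^{(q)}=\sum_{i_1\le i_2\le\cdots\le i_\ell}r^{|\{i_1,i_2,\ldots,i_\ell\}|}\,x_{i_1}^{\alpha_1}x_{i_2}^{\alpha_2}\cdots x_{i_\ell}^{\alpha_\ell},$$ where the sum is over all weakly increasing $\ell$-tuples $(i_1\le i_2\le\cdots\le i_\ell)$ of positive integers.
   Context: For an integer $m$, $[m]=\{1,2,\ldots,m\}$ (empty if $m\le 0$). A composition is a finite tuple $\alpha=(\alpha_1,\ldots,\alpha_k)$ of positive integers; its length is $\ell(\alpha)=k$, its size is $|\alpha|=\alpha_1+\cdots+\alpha_k$. $\mathrm{Comp}$ is the set of all compositions (including the empty one), and $\mathrm{Comp}_n$ the set of compositions of size $n$. For $\alpha=(\alpha_1,\ldots,\alpha_k)\in\mathrm{Comp}_n$ set $D(\alpha)=\{\alpha_1+\cdots+\alpha_i \mid i\in[k-1]\}\subseteq[n-1]$. For a composition $\beta=(\beta_1,\ldots,\beta_m)$, $M_\beta=\sum_{i_1<i_2<\cdots<i_m}x_{i_1}^{\beta_1}\cdots x_{i_m}^{\beta_m}\in\mathbf{k}[[x_1,x_2,x_3,\ldots]]$ (sum over strictly increasing tuples of positive integers). For $\alpha\in\mathrm{Comp}_n$, $\eta_\alpha^{(q)}=\sum_{\beta\in\mathrm{Comp}_n;\ D(\beta)\subseteq D(\alpha)}r^{\ell(\beta)}M_\beta$.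 *)

theory Defs
  imports "HOL-Analysis.Infinite_Sum" "HOL-Library.Poly_Mapping"
begin

section \<open>The power series ring \<open>k[[x\<^sub>1, x\<^sub>2, x\<^sub>3, \<dots>]]\<close>\<close>

text \<open>
  The variables are indexed by the type \<^typ>\<open>num\<close>, HOL's linearly ordered type of positive
  integers (whose least element is 1). A monomial is a finitely supported exponent
  function \<^typ>\<open>num \<Rightarrow>\<^sub>0 nat\<close>, and a power series is an arbitrary coefficient function on monomials.

  The coefficient ring has sort \<open>{comm_ring, comm_monoid_mult}\<close>: commutative rings with unity,
  where, unlike in \<open>comm_ring_1\<close>, the zero ring is not excluded.
\<close>

typedef 'a mps = "UNIV :: ((num \<Rightarrow>\<^sub>0 nat) \<Rightarrow> 'a) set"
  morphisms mps_coeff Abs_mps ..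

lemma mps_coeff_Abs_mps [simp]: "mps_coeff (Abs_mps f) = f"
  by (simp add: Abs_mps_inverse)

lemma mps_eqI: "(\<And>m. mps_coeff f m = mps_coeff g m) \<Longrightarrow> f = g"
  by (metis ext mps_coeff_inject)

lemma mps_eq_iff: "f = g \<longleftrightarrow> (\<forall>m. mps_coeff f m = mps_coeff g m)"
  using mps_eqI by blast

definition factor_pairs :: "(num \<Rightarrow>\<^sub>0 nat) \<Rightarrow> ((num \<Rightarrow>\<^sub>0 nat) \<times> (num \<Rightarrow>\<^sub>0 nat)) set" where
  "factor_pairs m = {(a, b). a + b = m}"

lemma finite_factor_pairs [simp]: "finite (factor_pairs m)"
proof -
  define N where "N = Max (Poly_Mapping.lookup m ` Poly_Mapping.keys m)"
  define B where "B = {f. \<forall>x. (x \<in> Poly_Mapping.keys m \<longrightarrow> f x \<in> {..N}) \<and>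
                                (x \<notin> Poly_Mapping.keys m \<longrightarrow> f x = 0)}"
  have "finite B"
    unfolding B_def by (rule finite_set_of_finite_funs) simp_all
  moreover have "inj Poly_Mapping.lookup"
    by (meson injI lookup_inject)
  ultimately have fin: "finite (Poly_Mapping.lookup -` B)"
    by (rule finite_vimageI)
  have in_B: "Poly_Mapping.lookup a \<in> B" if "a + b = m" for a b
  proof -
    have le: "Poly_Mapping.lookup a x \<le> Poly_Mapping.lookup m x" for x
      using that by (auto simp: lookup_add)
    have "Poly_Mapping.lookup a x \<le> N" if "x \<in> Poly_Mapping.keys m" for x
      unfolding N_def using le[of x] that
      by (meson Max_ge finite_imageI finite_keys imageI le_trans)
    moreover have "Poly_Mapping.lookup a x = 0" if "x \<notin> Poly_Mapping.keys m" for x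
      using le[of x] that by (simp add: in_keys_iff)
    ultimately show ?thesis by (simp add: B_def)
  qed
  have "factor_pairs m \<subseteq> (Poly_Mapping.lookup -` B) \<times> (Poly_Mapping.lookup -` B)"
  proof
    fix p assume "p \<in> factor_pairs m"
    then obtain a b where p: "p = (a, b)" "a + b = m"
      by (auto simp: factor_pairs_def)
    then have "b + a = m" by (simp add: add.commute)
    then show "p \<in> (Poly_Mapping.lookup -` B) \<times> (Poly_Mapping.lookup -` B)"
      using p in_B[of a b] in_B[of b a] by simp
  qed
  then show ?thesis
    by (rule finite_subset) (intro finite_cartesian_product fin)
qed

instantiation mps :: ("{comm_ring, comm_monoid_mult}") "{comm_ring, comm_monoid_mult}"
begin

definition "0 = Abs_mps (\<lambda>m. 0)"
definition "1 = Abs_mps (\<lambda>m. if m = 0 then 1 else 0)"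
definition "f + g = Abs_mps (\<lambda>m. mps_coeff f m + mps_coeff g m)"
definition "f - g = Abs_mps (\<lambda>m. mps_coeff f m - mps_coeff g m)"
definition "- f = Abs_mps (\<lambda>m. - mps_coeff f m)"
definition "f * g = Abs_mps (\<lambda>m. \<Sum>(a, b)\<in>factor_pairs m. mps_coeff f a * mps_coeff g b)"

instance
proof
  fix f g h :: "'a mps"
  show "f * g * h = f * (g * h)"
  proof (rule mps_eqI)
    fix m
    let ?l = "SIGMA p:factor_pairs m. factor_pairs (fst p)"
    let ?r = "SIGMA p:factor_pairs m. factor_pairs (snd p)"
    have "mps_coeff (f * g * h) m =
        (\<Sum>p\<in>factor_pairs m. \<Sum>s\<in>factor_pairs (fst p).
           mps_coeff f (fst s) * mps_coeff g (snd s) * mps_coeff h (snd p))"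
      by (simp add: times_mps_def case_prod_unfold sum_distrib_right)
    also have "\<dots> = (\<Sum>(p, s)\<in>?l. mps_coeff f (fst s) * mps_coeff g (snd s) * mps_coeff h (snd p))"
      by (rule sum.Sigma) auto
    also have "\<dots> = (\<Sum>(p, s)\<in>?r. mps_coeff f (fst p) * (mps_coeff g (fst s) * mps_coeff h (snd s)))"
      by (rule sum.reindex_bij_witness
          [where j = "\<lambda>((a, b), (c, d)). ((c, d + b), (d, b))"
             and i = "\<lambda>((a, b), (c, d)). ((a + c, d), (a, c))"])
         (auto simp: factor_pairs_def algebra_simps)
    also have "\<dots> = (\<Sum>p\<in>factor_pairs m. \<Sum>s\<in>factor_pairs (snd p).
           mps_coeff f (fst p) * (mps_coeff g (fst s) * mps_coeff h (snd s)))"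
      by (rule sum.Sigma [symmetric]) auto
    also have "\<dots> = mps_coeff (f * (g * h)) m"
      by (simp add: times_mps_def case_prod_unfold sum_distrib_left)
    finally show "mps_coeff (f * g * h) m = mps_coeff (f * (g * h)) m" .
  qed
  show "f * g = g * f"
  proof (rule mps_eqI)
    fix m
    show "mps_coeff (f * g) m = mps_coeff (g * f) m"
      unfolding times_mps_def mps_coeff_Abs_mps
      by (rule sum.reindex_bij_witness
          [where j = "\<lambda>(a, b). (b, a)" and i = "\<lambda>(a, b). (b, a)"])
         (auto simp: factor_pairs_def algebra_simps)
  qed
  show "1 * f = f"
  proof (rule mps_eqI)
    fix m
    have "mps_coeff (1 * f) m =
        (\<Sum>(a, b)\<in>factor_pairs m. (if a = 0 then 1 else 0) * mps_coeff f b)"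
      by (simp add: times_mps_def one_mps_def)
    also have "\<dots> = (\<Sum>(a, b)\<in>{(0 :: num \<Rightarrow>\<^sub>0 nat, m)}. (if a = 0 then 1 else 0) * mps_coeff f b)"
      by (rule sum.mono_neutral_right)
         (use finite_factor_pairs in \<open>auto simp: factor_pairs_def split: if_splits\<close>)
    finally show "mps_coeff (1 * f) m = mps_coeff f m" by simp
  qed
  show "(f + g) * h = f * h + g * h"
    by (rule mps_eqI)
       (simp add: times_mps_def plus_mps_def case_prod_unfold distrib_right sum.distrib)
qed (auto simp: mps_eq_iff zero_mps_def plus_mps_def minus_mps_def uminus_mps_def algebra_simps)

end

lemma mps_coeff_zero [simp]: "mps_coeff 0 m = 0"
  and mps_coeff_one: "mps_coeff 1 m = (if m = 0 then 1 else 0)"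
  and mps_coeff_add [simp]: "mps_coeff (f + g) m = mps_coeff f m + mps_coeff g m"
  and mps_coeff_diff [simp]: "mps_coeff (f - g) m = mps_coeff f m - mps_coeff g m"
  and mps_coeff_uminus [simp]: "mps_coeff (- f) m = - mps_coeff f m"
  and mps_coeff_mult: "mps_coeff (f * g) m = (\<Sum>(a, b)\<in>factor_pairs m. mps_coeff f a * mps_coeff g b)"
  by (simp_all add: zero_mps_def one_mps_def plus_mps_def minus_mps_def uminus_mps_def times_mps_def)

lemma mps_coeff_sum: "mps_coeff (sum f A) m = (\<Sum>i\<in>A. mps_coeff (f i) m)"
  by (induction A rule: infinite_finite_induct) auto

definition mps_const :: "'a \<Rightarrow> 'a::{comm_ring, comm_monoid_mult} mps" where
  "mps_const c = Abs_mps (\<lambda>m. if m = 0 then c else 0)"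

definition mps_var :: "num \<Rightarrow> 'a::{comm_ring, comm_monoid_mult} mps" where
  "mps_var i = Abs_mps (\<lambda>m. if m = Poly_Mapping.single i 1 then 1 else 0)"

lemma mps_monomial_mult:
  "Abs_mps (\<lambda>m. if m = a then 1 else 0) * Abs_mps (\<lambda>m. if m = b then 1 else 0) =
   (Abs_mps (\<lambda>m. if m = a + b then 1 else 0) :: 'a::{comm_ring, comm_monoid_mult} mps)"
proof (rule mps_eqI)
  fix m
  have "(\<Sum>(c, d)\<in>factor_pairs m. (if c = a then 1 else 0) * (if d = b then 1 else 0) :: 'a) =
      (\<Sum>p\<in>factor_pairs m. if p = (a, b) then 1 else 0)"
    by (rule sum.cong) (auto split: if_splits)
  also have "\<dots> = (if m = a + b then 1 else 0)"
    by (simp add: sum.delta) (auto simp: factor_pairs_def)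
  finally show "mps_coeff (Abs_mps (\<lambda>m. if m = a then 1 else 0) *
        Abs_mps (\<lambda>m. if m = b then 1 else 0)) m =
      mps_coeff (Abs_mps (\<lambda>m. if m = a + b then 1 else 0) :: 'a mps) m"
    by (simp add: mps_coeff_mult)
qed

lemma mps_var_power:
  "mps_var i ^ n = Abs_mps (\<lambda>m. if m = Poly_Mapping.single i n then 1 else 0)"
proof (induction n)
  case 0
  show ?case by (simp add: one_mps_def)
next
  case (Suc n)
  have "Poly_Mapping.single i 1 + Poly_Mapping.single i n = Poly_Mapping.single i (Suc n)"
    by (simp flip: single_add)
  then show ?case
    unfolding power_Suc Suc.IH unfolding mps_var_def by (simp only: mps_monomial_mult)
qed

lemma mps_coeff_prod_var:
  fixes n :: nat
  shows "mps_coeff (\<Prod>j<n. mps_var (i j) ^ e j :: 'a::{comm_ring, comm_monoid_mult} mps) m =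
     (if m = (\<Sum>j<n. Poly_Mapping.single (i j) (e j)) then 1 else 0)"
proof -
  have "(\<Prod>j<n. mps_var (i j) ^ e j :: 'a mps) =
      Abs_mps (\<lambda>m. if m = (\<Sum>j<n. Poly_Mapping.single (i j) (e j)) then 1 else 0)"
    by (induction n) (simp_all add: one_mps_def mps_var_power mps_monomial_mult)
  then show ?thesis by simp
qed


subsection \<open>Infinite sums of power series\<close>

text \<open>
  Power series carry the product topology, with each coefficient discrete. Convergence of an
  infinite sum thus means that every monomial occurs in only finitely many summands, as shown
  by lemma \<open>has_sum_mps_iff\<close> below.
\<close>

instantiation mps :: (type) t2_space
begin

definition open_mps :: "'a mps set \<Rightarrow> bool" where
  "open_mps U \<longleftrightarrow> (\<forall>f\<in>U. \<exists>F. finite F \<and>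
     (\<forall>g. (\<forall>m\<in>F. mps_coeff g m = mps_coeff f m) \<longrightarrow> g \<in> U))"

instance
proof
  show "open (UNIV :: 'a mps set)"
    by (auto simp: open_mps_def)
next
  fix S T :: "'a mps set"
  assume S: "open S" and T: "open T"
  show "open (S \<inter> T)"
    unfolding open_mps_def
  proof
    fix f assume "f \<in> S \<inter> T"
    then have fS: "f \<in> S" and fT: "f \<in> T" by auto
    obtain F where "finite F" "\<forall>g. (\<forall>m\<in>F. mps_coeff g m = mps_coeff f m) \<longrightarrow> g \<in> S"
      using bspec[OF S[unfolded open_mps_def] fS] by (elim exE conjE)
    moreover obtain G where "finite G" "\<forall>g. (\<forall>m\<in>G. mps_coeff g m = mps_coeff f m) \<longrightarrow> g \<in> T"
      using bspec[OF T[unfolded open_mps_def] fT] by (elim exE conjE)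
    ultimately show "\<exists>F. finite F \<and> (\<forall>g. (\<forall>m\<in>F. mps_coeff g m = mps_coeff f m) \<longrightarrow> g \<in> S \<inter> T)"
      by (intro exI[of _ "F \<union> G"]) auto
  qed
next
  fix K :: "'a mps set set"
  assume K: "\<forall>S\<in>K. open S"
  show "open (\<Union>K)"
    unfolding open_mps_def
  proof
    fix f assume "f \<in> \<Union>K"
    then obtain S where "S \<in> K" "f \<in> S" by blast
    then have S: "open S" using K by blast
    obtain F where "finite F" "\<forall>g. (\<forall>m\<in>F. mps_coeff g m = mps_coeff f m) \<longrightarrow> g \<in> S"
      using bspec[OF S[unfolded open_mps_def] \<open>f \<in> S\<close>] by (elim exE conjE)
    then show "\<exists>F. finite F \<and> (\<forall>g. (\<forall>m\<in>F. mps_coeff g m = mps_coeff f m) \<longrightarrow> g \<in> \<Union>K)"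
      using \<open>S \<in> K\<close> by (intro exI[of _ F]) auto
  qed
next
  fix f g :: "'a mps"
  assume "f \<noteq> g"
  then obtain m where m: "mps_coeff f m \<noteq> mps_coeff g m"
    using mps_eqI by blast
  have "open {h. mps_coeff h m = c}" for c :: 'a
    unfolding open_mps_def by (auto intro!: exI[of _ "{m}"])
  then show "\<exists>U V. open U \<and> open V \<and> f \<in> U \<and> g \<in> V \<and> U \<inter> V = {}"
    using m
    by (intro exI[of _ "{h. mps_coeff h m = mps_coeff f m}"]
        exI[of _ "{h. mps_coeff h m = mps_coeff g m}"]) auto
qed

end

lemma tendsto_mps_iff:
  "(f \<longlongrightarrow> l) F \<longleftrightarrow> (\<forall>m. eventually (\<lambda>x. mps_coeff (f x) m = mps_coeff l m) F)"
proof
  assume lim: "(f \<longlongrightarrow> l) F"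
  show "\<forall>m. eventually (\<lambda>x. mps_coeff (f x) m = mps_coeff l m) F"
  proof
    fix m
    have "open {h. mps_coeff h m = mps_coeff l m}"
      unfolding open_mps_def by (auto intro!: exI[of _ "{m}"])
    from topological_tendstoD[OF lim this]
    show "eventually (\<lambda>x. mps_coeff (f x) m = mps_coeff l m) F" by simp
  qed
next
  assume ev: "\<forall>m. eventually (\<lambda>x. mps_coeff (f x) m = mps_coeff l m) F"
  show "(f \<longlongrightarrow> l) F"
  proof (rule topological_tendstoI)
    fix S assume "open S" "l \<in> S"
    then obtain G where G: "finite G" "\<And>g. (\<forall>m\<in>G. mps_coeff g m = mps_coeff l m) \<Longrightarrow> g \<in> S"
      unfolding open_mps_def by meson
    have "eventually (\<lambda>x. \<forall>m\<in>G. mps_coeff (f x) m = mps_coeff l m) F"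
      using G(1) ev by (simp add: eventually_ball_finite)
    then show "eventually (\<lambda>x. f x \<in> S) F"
      by (rule eventually_mono) (rule G(2))
  qed
qed

lemma eventually_sum_eq_iff:
  fixes c :: "'i \<Rightarrow> 'a::{comm_ring, comm_monoid_mult}"
  shows "eventually (\<lambda>Y. sum c Y = s) (finite_subsets_at_top A) \<longleftrightarrow>
    finite {i\<in>A. c i \<noteq> 0} \<and> s = sum c {i\<in>A. c i \<noteq> 0}"
proof
  assume "eventually (\<lambda>Y. sum c Y = s) (finite_subsets_at_top A)"
  then obtain X where X: "finite X" "X \<subseteq> A"
    and Y: "\<forall>Y. finite Y \<and> X \<subseteq> Y \<and> Y \<subseteq> A \<longrightarrow> sum c Y = s"
    unfolding eventually_finite_subsets_at_top by blast
  have sX: "sum c X = s" using X Y by blast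
  have sub: "{i\<in>A. c i \<noteq> 0} \<subseteq> X"
  proof
    fix i assume i: "i \<in> {i\<in>A. c i \<noteq> 0}"
    show "i \<in> X"
    proof (rule ccontr)
      assume "i \<notin> X"
      then have "sum c (insert i X) = c i + s" using X sX by simp
      moreover have "sum c (insert i X) = s" using X Y i by blast
      ultimately show False using i by simp
    qed
  qed
  moreover have "sum c X = sum c {i\<in>A. c i \<noteq> 0}"
    by (rule sum.mono_neutral_right) (use X sub in auto)
  ultimately show "finite {i\<in>A. c i \<noteq> 0} \<and> s = sum c {i\<in>A. c i \<noteq> 0}"
    using X(1) sX finite_subset by metis
next
  assume Z: "finite {i\<in>A. c i \<noteq> 0} \<and> s = sum c {i\<in>A. c i \<noteq> 0}"
  have "sum c Y = s" if "finite Y" "{i\<in>A. c i \<noteq> 0} \<subseteq> Y" "Y \<subseteq> A" for Y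
  proof -
    have "sum c Y = sum c {i\<in>A. c i \<noteq> 0}"
      by (rule sum.mono_neutral_right) (use that in auto)
    with Z show ?thesis by metis
  qed
  with Z show "eventually (\<lambda>Y. sum c Y = s) (finite_subsets_at_top A)"
    unfolding eventually_finite_subsets_at_top
    by (intro exI[of _ "{i\<in>A. c i \<noteq> 0}"]) blast
qed

lemma has_sum_mps_iff:
  "(f has_sum s) A \<longleftrightarrow>
     (\<forall>m. finite {i\<in>A. mps_coeff (f i) m \<noteq> 0} \<and>
          mps_coeff s m = (\<Sum>i | i \<in> A \<and> mps_coeff (f i) m \<noteq> 0. mps_coeff (f i) m))"
  unfolding has_sum_def tendsto_mps_iff mps_coeff_sum eventually_sum_eq_iff ..


section \<open>Compositions\<close>

definition Comp :: "nat list set" where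
  "Comp = {\<alpha>. \<forall>a\<in>set \<alpha>. 0 < a}"

definition Comp_of :: "nat \<Rightarrow> nat list set" where
  "Comp_of n = {\<alpha>\<in>Comp. sum_list \<alpha> = n}"

definition partial_sums :: "nat list \<Rightarrow> nat set" where
  "partial_sums \<alpha> = {sum_list (take i \<alpha>) | i. i \<in> {1..<length \<alpha>}}"

lemma finite_Comp_of [simp]: "finite (Comp_of n)"
proof (rule finite_subset)
  have "length \<alpha> \<le> sum_list \<alpha>" if "\<forall>a\<in>set \<alpha>. 0 < a" for \<alpha> :: "nat list"
    using that by (induction \<alpha>) auto
  then show "Comp_of n \<subseteq> {\<alpha>. set \<alpha> \<subseteq> {..n} \<and> length \<alpha> \<le> n}"
    by (auto simp: Comp_of_def Comp_def member_le_sum_list)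
qed (simp add: finite_lists_length_le)


section \<open>Monomial quasisymmetric functions and the functions \<open>\<eta>\<^sup>(\<^sup>q\<^sup>)\<close>\<close>

definition mon_qsym :: "nat list \<Rightarrow> 'a::{comm_ring, comm_monoid_mult} mps" where
  "mon_qsym \<beta> = (\<Sum>\<^sub>\<infinity>is\<in>{is :: num list. length is = length \<beta> \<and> sorted_wrt (<) is}.
     \<Prod>j<length \<beta>. mps_var (is ! j) ^ (\<beta> ! j))"

text \<open>Since \<^const>\<open>infsum\<close> is 0 for divergent families, we check that this one is summable.\<close>

lemma summable_mon_qsym:
  assumes "\<beta> \<in> Comp"
  shows "(\<lambda>is. \<Prod>j<length \<beta>. mps_var (is ! j) ^ (\<beta> ! j) :: 'a::{comm_ring, comm_monoid_mult} mps)
    summable_on {is :: num list. length is = length \<beta> \<and> sorted_wrt (<) is}"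
    (is "?f summable_on ?A")
proof -
  have "finite {is\<in>?A. mps_coeff (?f is) m \<noteq> 0}" for m
  proof (rule finite_subset)
    show "{is\<in>?A. mps_coeff (?f is) m \<noteq> 0} \<subseteq>
        {is. set is \<subseteq> Poly_Mapping.keys m \<and> length is = length \<beta>}"
    proof clarify
      fix "is" i
      assume len: "length is = length \<beta>" and nz: "mps_coeff (?f is) m \<noteq> 0" and "i \<in> set is"
      then obtain k where k: "k < length \<beta>" "i = is ! k"
        by (metis in_set_conv_nth)
      have "m = (\<Sum>j<length \<beta>. Poly_Mapping.single (is ! j) (\<beta> ! j))"
        using nz by (auto simp: mps_coeff_prod_var split: if_splits)
      then have "Poly_Mapping.lookup m i =
          (\<Sum>j<length \<beta>. Poly_Mapping.lookup (Poly_Mapping.single (is ! j) (\<beta> ! j)) i)"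
        by (simp add: lookup_sum)
      also have "\<dots> \<ge> Poly_Mapping.lookup (Poly_Mapping.single (is ! k) (\<beta> ! k)) i"
        using k(1) by (intro member_le_sum) auto
      finally have "\<beta> ! k \<le> Poly_Mapping.lookup m i"
        using k(2) by simp
      moreover have "0 < \<beta> ! k"
        using assms k(1) by (simp add: Comp_def)
      ultimately show "i \<in> Poly_Mapping.keys m"
        by (simp add: in_keys_iff)
    qed
  qed (simp add: finite_lists_length_eq)
  then have "(?f has_sum Abs_mps (\<lambda>m. \<Sum>is | is \<in> ?A \<and> mps_coeff (?f is) m \<noteq> 0. mps_coeff (?f is) m)) ?A"
    by (simp add: has_sum_mps_iff)
  then show ?thesis
    unfolding summable_on_def by blast
qed

definition eta :: "'a \<Rightarrow> nat list \<Rightarrow> 'a::{comm_ring, comm_monoid_mult} mps" where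
  "eta q \<alpha> = (\<Sum>\<beta> | \<beta> \<in> Comp_of (sum_list \<alpha>) \<and> partial_sums \<beta> \<subseteq> partial_sums \<alpha>.
     mps_const ((q + 1) ^ length \<beta>) * mon_qsym \<beta>)"

end

theory Submission
  imports Defs
begin

text \<open>
  Both sides are compared coefficient by coefficient, and each side turns out to have at most one
  term at every monomial \<open>m\<close>. A monomial determines the strictly increasing list of the variables
  that occur in it and the composition of their exponents, its shape. Hence \<open>M\<^sub>\<beta>\<close> is the sum
  of the monomials of shape \<open>\<beta>\<close>, and the coefficient of \<open>\<eta>\<close> at \<open>m\<close> is \<open>r\<close> to the number
  of variables in \<open>m\<close> if the shape of \<open>m\<close> is a coarsening of \<open>\<alpha>\<close>, that is, has the same size
  and its partial sums among those of \<open>\<alpha>\<close>; otherwise it is 0 (\<open>mps_coeff_eta\<close>).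

  On the other side, a weakly increasing tuple \<open>i\<close> is determined by \<open>\<alpha>\<close> and the
  resulting monomial: its first entry is the least variable, and one removes that entry and
  continues (\<open>inj_on_exponents\<close>). The set of its entries is the set of
  variables of the monomial, so the powers of \<open>r\<close> agree too.

  It remains to see that the monomials arising from weakly increasing tuples are those whose shape
  is a coarsening of \<open>\<alpha>\<close>. Adding up the exponents over each run of equal
  indices produces a coarsening (\<open>merge_equal_indices\<close>); conversely, if the shape is a coarsening,
  each of its parts is a sum of consecutive parts of \<open>\<alpha>\<close>, and repeating the corresponding index
  once for each of those gives the tuple (\<open>split_strict_indices\<close>).
\<close>

section \<open>Coefficients of sums of monomial terms\<close>

lemma mps_coeff_const_mult: "mps_coeff (mps_const c * f) m = c * mps_coeff f m"
proof -
  have "mps_coeff (mps_const c * f) m =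
      (\<Sum>(a, b)\<in>factor_pairs m. (if a = 0 then c else 0) * mps_coeff f b)"
    by (simp add: mps_coeff_mult mps_const_def)
  also have "\<dots> = (\<Sum>(a, b)\<in>{(0 :: num \<Rightarrow>\<^sub>0 nat, m)}. (if a = 0 then c else 0) * mps_coeff f b)"
    by (rule sum.mono_neutral_right)
       (use finite_factor_pairs in \<open>auto simp: factor_pairs_def split: if_splits\<close>)
  finally show ?thesis by simp
qed

text \<open>
  If distinct summands are multiples of distinct monomials, no coefficients are ever
  added up: every monomial receives at most one contribution, so summability is automatic and
  the sum can be read off. Both infinite sums below, \<open>M\<^sub>\<beta>\<close> and the sum over weakly increasing
  tuples, are of this kind.
\<close>
lemma has_sum_monomial_terms:
  assumes inj: "inj_on e A"
    and f: "\<And>i m. i \<in> A \<Longrightarrow> mps_coeff (f i) m = (if m = e i then c i else 0)"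
    and g: "\<And>i. i \<in> A \<Longrightarrow> mps_coeff g (e i) = c i"
    and g0: "\<And>m. m \<notin> e ` A \<Longrightarrow> mps_coeff g m = 0"
  shows "(f has_sum g) A"
  unfolding has_sum_mps_iff
proof
  fix m
  let ?S = "{i \<in> A. mps_coeff (f i) m \<noteq> 0}"
  show "finite ?S \<and> mps_coeff g m = (\<Sum>i | i \<in> A \<and> mps_coeff (f i) m \<noteq> 0. mps_coeff (f i) m)"
  proof (cases "m \<in> e ` A")
    case True
    then obtain i where i: "i \<in> A" "m = e i" by blast
    have sub: "?S \<subseteq> {i}"
      using i f inj by (auto simp: inj_on_def split: if_splits)
    have "(\<Sum>i\<in>?S. mps_coeff (f i) m) = (\<Sum>i\<in>{i}. mps_coeff (f i) m)"
      by (rule sum.mono_neutral_left) (use sub i in auto)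
    then show ?thesis
      using finite_subset[OF sub] f[OF i(1)] g[OF i(1)] i(2) by simp
  next
    case False
    then have "?S = {}" using f by auto
    then show ?thesis using g0[OF False] by (simp only: sum.empty finite.emptyI simp_thms)
  qed
qed


section \<open>Exponents of a word of variables\<close>

text \<open>
  The monomial whose factors are the variables \<open>is\<close> raised to the parts of \<open>\<alpha>\<close>. Summing along
  the zipped lists rather than over positions makes it recursive in both lists, which the
  inductions below rely on.
\<close>
definition exponents :: "nat list \<Rightarrow> num list \<Rightarrow> (num \<Rightarrow>\<^sub>0 nat)" where
  "exponents \<alpha> is = (\<Sum>(i, a)\<leftarrow>zip is \<alpha>. Poly_Mapping.single i a)"

lemma exponents_Nil [simp]: "exponents [] is = 0"
  and exponents_Cons [simp]:
    "exponents (a # \<alpha>) (i # is) = Poly_Mapping.single i a + exponents \<alpha> is"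
  by (simp_all add: exponents_def)

lemma mps_coeff_monomial:
  assumes "length is = length \<alpha>"
  shows "mps_coeff (\<Prod>j<length \<alpha>. mps_var (is ! j) ^ (\<alpha> ! j) ::
      'a::{comm_ring, comm_monoid_mult} mps) m = (if m = exponents \<alpha> is then 1 else 0)"
  using assms
  by (simp add: mps_coeff_prod_var exponents_def sum_list_sum_nth atLeast0LessThan)

lemma Comp_Nil [simp]: "[] \<in> Comp"
  and Comp_Cons [simp]: "a # \<alpha> \<in> Comp \<longleftrightarrow> 0 < a \<and> \<alpha> \<in> Comp"
  by (auto simp: Comp_def)

lemma keys_exponents:
  assumes "length is = length \<alpha>" "\<alpha> \<in> Comp"
  shows "Poly_Mapping.keys (exponents \<alpha> is) = set is"
  using assms
proof (induction "is" \<alpha> rule: list_induct2)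
  case (Cons i "is" a \<alpha>)
  then show ?case
    by (auto simp: set_eq_iff in_keys_iff lookup_add lookup_single when_def)
qed simp

text \<open>
  Positivity of the parts matters here: it makes every index of the tuple visible in the
  monomial, so that the first index can be recovered as the least variable.
\<close>
lemma inj_on_exponents:
  assumes "\<alpha> \<in> Comp"
  shows "inj_on (exponents \<alpha>) {is. length is = length \<alpha> \<and> sorted is}"
  using assms
proof (induction \<alpha>)
  case (Cons a \<alpha>)
  show ?case
  proof (rule inj_onI, clarify)
    fix xs ys :: "num list"
    assume len: "length xs = length (a # \<alpha>)" "length ys = length (a # \<alpha>)"
      and srt: "sorted xs" "sorted ys"
      and eq: "exponents (a # \<alpha>) xs = exponents (a # \<alpha>) ys"
    obtain i xs' j ys' where xy: "xs = i # xs'" "ys = j # ys'"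
      using len by (auto simp: length_Suc_conv)
    have "set xs = set ys"
      using keys_exponents[of xs "a # \<alpha>"] keys_exponents[of ys "a # \<alpha>"] len eq Cons.prems by simp
    \<comment> \<open>By sortedness, both heads are the least element of this set.\<close>
    then have "i = j"
      using srt xy by (metis antisym list.set_intros(1) set_ConsD sorted_simps(2))
    moreover have "xs' = ys'"
      using Cons.IH Cons.prems len srt eq xy \<open>i = j\<close> by (auto simp: inj_on_def)
    ultimately show "xs = ys" using xy by simp
  qed
qed (auto simp: inj_on_def)

section \<open>The shape of a monomial\<close>

definition shape :: "(num \<Rightarrow>\<^sub>0 nat) \<Rightarrow> nat list" where
  "shape m = map (Poly_Mapping.lookup m) (sorted_list_of_set (Poly_Mapping.keys m))"

lemma shape_in_Comp: "shape m \<in> Comp"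
  by (auto simp: shape_def Comp_def in_keys_iff)

lemma length_shape: "length (shape m) = card (Poly_Mapping.keys m)"
  by (simp add: shape_def)

lemma map_lookup_exponents:
  assumes "length js = length \<beta>" "distinct js"
  shows "map (Poly_Mapping.lookup (exponents \<beta> js)) js = \<beta>"
  using assms
proof (induction js \<beta> rule: list_induct2)
  case (Cons j js b \<beta>)
  have "Poly_Mapping.lookup (exponents \<beta> js) j = 0" if "j \<notin> set js"
    using \<open>length js = length \<beta>\<close> that
    by (induction js \<beta> rule: list_induct2) (auto simp: lookup_add lookup_single)
  moreover have "map (Poly_Mapping.lookup (Poly_Mapping.single j b + exponents \<beta> js)) js =
      map (Poly_Mapping.lookup (exponents \<beta> js)) js"
    using Cons.prems by (auto simp: lookup_add lookup_single when_def)
  ultimately show ?case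
    using Cons by (simp add: lookup_add cong: map_cong)
qed simp

text \<open>
  Together with \<open>exponents_shape\<close> below, this says that a monomial is written in exactly one way
  as a product of positive powers along a strictly increasing list of variables.
\<close>
lemma shape_exponents:
  assumes "length js = length \<beta>" "\<beta> \<in> Comp" "sorted_wrt (<) js"
  shows "shape (exponents \<beta> js) = \<beta>"
proof -
  have "sorted_list_of_set (set js) = js"
    using assms(3) by (metis sorted_list_of_set.idem_if_sorted_distinct strict_sorted_iff)
  then show ?thesis
    using assms by (simp add: shape_def keys_exponents map_lookup_exponents strict_sorted_iff)
qed

lemma exponents_shape: "exponents (shape m) (sorted_list_of_set (Poly_Mapping.keys m)) = m"
proof (rule poly_mapping_eqI)
  fix i
  let ?js = "sorted_list_of_set (Poly_Mapping.keys m)"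
  let ?m' = "exponents (shape m) ?js"
  have keys: "Poly_Mapping.keys ?m' = Poly_Mapping.keys m"
    by (subst keys_exponents) (simp_all add: shape_in_Comp length_shape)
  have "map (Poly_Mapping.lookup ?m') ?js = map (Poly_Mapping.lookup m) ?js"
    by (subst map_lookup_exponents) (simp_all add: shape_def)
  then have "Poly_Mapping.lookup ?m' i = Poly_Mapping.lookup m i" if "i \<in> Poly_Mapping.keys m"
    using that by simp
  then show "Poly_Mapping.lookup ?m' i = Poly_Mapping.lookup m i"
    using keys by (metis in_keys_iff)
qed

lemma mps_coeff_mon_qsym:
  assumes "\<beta> \<in> Comp"
  shows "mps_coeff (mon_qsym \<beta> :: 'a::{comm_ring, comm_monoid_mult} mps) m =
    (if shape m = \<beta> then 1 else 0)"
proof -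
  define g :: "'a mps" where "g = Abs_mps (\<lambda>m. if shape m = \<beta> then 1 else 0)"
  let ?A = "{is :: num list. length is = length \<beta> \<and> sorted_wrt (<) is}"
  have "((\<lambda>is. \<Prod>j<length \<beta>. mps_var (is ! j) ^ (\<beta> ! j)) has_sum g) ?A"
  proof (rule has_sum_monomial_terms)
    show "inj_on (exponents \<beta>) ?A"
      by (rule inj_on_subset[OF inj_on_exponents[OF assms]]) (auto simp: strict_sorted_iff)
  next
    fix "is" m assume "is \<in> ?A"
    then show "mps_coeff (\<Prod>j<length \<beta>. mps_var (is ! j) ^ (\<beta> ! j) :: 'a mps) m =
        (if m = exponents \<beta> is then 1 else 0)"
      by (simp add: mps_coeff_monomial)
  next
    fix "is" assume "is \<in> ?A"
    then show "mps_coeff g (exponents \<beta> is) = 1"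
      using assms by (simp add: g_def shape_exponents)
  next
    fix m assume notin: "m \<notin> exponents \<beta> ` ?A"
    have "shape m \<noteq> \<beta>"
    proof
      assume "shape m = \<beta>"
      then have "sorted_list_of_set (Poly_Mapping.keys m) \<in> ?A"
          "exponents \<beta> (sorted_list_of_set (Poly_Mapping.keys m)) = m"
        using exponents_shape[of m] by (auto simp: length_shape)
      then show False using notin by (metis imageI)
    qed
    then show "mps_coeff g m = 0" by (simp add: g_def)
  qed
  then have "mon_qsym \<beta> = g"
    unfolding mon_qsym_def by (rule infsumI)
  then show ?thesis by (simp add: g_def)
qed

lemma mps_coeff_eta:
  "mps_coeff (eta q \<alpha>) m =
    (if sum_list (shape m) = sum_list \<alpha> \<and> partial_sums (shape m) \<subseteq> partial_sums \<alpha>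
     then (q + 1) ^ card (Poly_Mapping.keys m) else 0)"
proof -
  let ?B = "{\<beta> \<in> Comp_of (sum_list \<alpha>). partial_sums \<beta> \<subseteq> partial_sums \<alpha>}"
  have "mps_coeff (eta q \<alpha>) m =
      (\<Sum>\<beta>\<in>?B. (q + 1) ^ length \<beta> * mps_coeff (mon_qsym \<beta>) m)"
    by (simp add: eta_def mps_coeff_sum mps_coeff_const_mult)
  also have "\<dots> = (\<Sum>\<beta>\<in>?B. if \<beta> = shape m then (q + 1) ^ length \<beta> else 0)"
    by (rule sum.cong) (auto simp: Comp_of_def mps_coeff_mon_qsym)
  also have "\<dots> = (if shape m \<in> ?B then (q + 1) ^ length (shape m) else 0)"
    by (rule sum.delta) simp
  finally show ?thesis
    by (simp add: Comp_of_def shape_in_Comp length_shape)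
qed


section \<open>Coarsenings and runs of equal indices\<close>

lemma partial_sums_Nil [simp]: "partial_sums [] = {}"
  by (simp add: partial_sums_def)

lemma partial_sums_Cons:
  "partial_sums (a # \<alpha>) = (if \<alpha> = [] then {} else insert a ((+) a ` partial_sums \<alpha>))"
proof (cases "\<alpha> = []")
  case False
  have "{1..<length (a # \<alpha>)} = insert 1 (Suc ` {1..<length \<alpha>})"
    using False by (auto simp: Suc_le_eq)
  moreover have "partial_sums \<beta> = (\<lambda>i. sum_list (take i \<beta>)) ` {1..<length \<beta>}" for \<beta>
    by (auto simp: partial_sums_def)
  ultimately show ?thesis
    using False by (simp add: image_image flip: image_Suc_atLeastLessThan)
qed (simp add: partial_sums_def)

lemma partial_sums_pos:
  assumes "\<alpha> \<in> Comp" "d \<in> partial_sums \<alpha>"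
  shows "0 < d"
  using assms by (cases \<alpha>) (auto simp: partial_sums_Cons split: if_splits)

text \<open>
  The partial sums of \<open>a # b # \<beta>\<close> are \<open>a\<close> and the elements of the right-hand side, so merging
  its first two parts just loses the partial sum \<open>a\<close>.
\<close>
lemma partial_sums_merge:
  "partial_sums ((a + b) # \<beta>) = (+) a ` partial_sums (b # \<beta>)"
  by (auto simp: partial_sums_Cons image_image add.assoc)

text \<open>
  Built up from the right: a new smallest index is put in front as a part of its own, while an
  index equal to the current first one has its exponent absorbed into the first part.
\<close>
lemma merge_equal_indices:
  assumes "length is = length \<alpha>" "\<alpha> \<in> Comp" "sorted is"
  shows "\<exists>\<beta> js. length js = length \<beta> \<and> \<beta> \<in> Comp \<and> sorted_wrt (<) js \<and> set js = set is \<and>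
    exponents \<beta> js = exponents \<alpha> is \<and>
    sum_list \<beta> = sum_list \<alpha> \<and> partial_sums \<beta> \<subseteq> partial_sums \<alpha>"
  using assms
proof (induction "is" \<alpha> rule: list_induct2)
  case Nil
  show ?case by (intro exI[of _ "[]"]) simp
next
  case (Cons i "is" a \<alpha>)
  have "\<alpha> \<in> Comp" "sorted is" using Cons.prems by simp_all
  note IH0 = Cons.IH[OF this]
  obtain \<beta> js where IH: "length js = length \<beta>" "\<beta> \<in> Comp" "sorted_wrt (<) js"
      "set js = set is" "exponents \<beta> js = exponents \<alpha> is"
      "sum_list \<beta> = sum_list \<alpha>" "partial_sums \<beta> \<subseteq> partial_sums \<alpha>"
    using IH0 by blast
  show ?case
  proof (cases "i \<in> set is")
    case False
    have "i < j" if "j \<in> set js" for j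
    proof (rule le_neq_trans)
      show "i \<le> j" "i \<noteq> j"
        using False Cons.prems IH(4) that by auto
    qed
    moreover have "\<alpha> = [] \<longleftrightarrow> \<beta> = []"
      using IH Cons.hyps by (metis length_0_conv set_empty)
    ultimately show ?thesis
      using IH Cons.prems
      by (intro exI[of _ "a # \<beta>"] exI[of _ "i # js"]) (auto simp: partial_sums_Cons)
  next
    case True
    then obtain j js' b \<beta>' where split: "js = j # js'" "\<beta> = b # \<beta>'"
      using IH by (cases js; cases \<beta>) auto
    \<comment> \<open>Both \<open>i\<close> and \<open>j\<close> are least in \<open>set is\<close>, so \<open>i\<close> continues the run of \<open>j\<close>.\<close>
    have "\<forall>k\<in>set is. j \<le> k" "j \<in> set is"
      unfolding IH(4)[symmetric] using IH(3) split(1) by (auto intro: less_imp_le)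
    moreover have "\<forall>k\<in>set is. i \<le> k"
      using Cons.prems by simp
    ultimately have "j = i"
      using True by (metis antisym)
    have "\<alpha> \<noteq> []" using True Cons.hyps by auto
    then have "partial_sums ((a + b) # \<beta>') \<subseteq> partial_sums (a # \<alpha>)"
      unfolding partial_sums_merge partial_sums_Cons[of a \<alpha>]
      using image_mono[OF IH(7), of "(+) a"] split(2) by auto
    moreover have "exponents ((a + b) # \<beta>') js = exponents (a # \<alpha>) (i # is)"
      using split \<open>j = i\<close> by (simp add: single_add add.assoc flip: IH(5))
    ultimately show ?thesis
      using IH split True Cons.prems
      by (intro exI[of _ "(a + b) # \<beta>'"] exI[of _ js]) (auto simp: insert_absorb)
  qed
qed

text \<open>
  Undoes the merging by peeling the parts of \<open>\<alpha>\<close> off the first part \<open>b\<close> of \<open>\<beta>\<close>. The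
  inclusion of partial sums (or the equality of sizes, if \<open>b\<close> is the only part left) prevents a
  part \<open>a\<close> of \<open>\<alpha>\<close> from straddling two parts of \<open>\<beta>\<close>: it forces \<open>a \<le> b\<close>. If
  \<open>a = b\<close> the first block is complete and the next
  index is taken up; otherwise the rest \<open>b - a\<close> still belongs to the same index.
\<close>
lemma split_strict_indices:
  assumes "\<alpha> \<in> Comp" "\<beta> \<in> Comp" "length js = length \<beta>" "sorted_wrt (<) js"
    "sum_list \<beta> = sum_list \<alpha>" "partial_sums \<beta> \<subseteq> partial_sums \<alpha>"
  shows "\<exists>is. length is = length \<alpha> \<and> sorted is \<and> set is = set js \<and>
    exponents \<alpha> is = exponents \<beta> js"
  using assms
proof (induction \<alpha> arbitrary: \<beta> js)
  case Nil
  then have "\<beta> = []" by (cases \<beta>) auto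
  then show ?case using Nil by simp
next
  case (Cons a \<alpha>)
  have a: "0 < a" and \<alpha>: "\<alpha> \<in> Comp" using Cons.prems by auto
  have "\<beta> \<noteq> []" using Cons.prems by auto
  then obtain b \<beta>' j js' where split: "\<beta> = b # \<beta>'" "js = j # js'"
    using Cons.prems(3) by (cases \<beta>; cases js) auto
  have \<beta>': "0 < b" "\<beta>' \<in> Comp" using Cons.prems split by auto
  have sub: "partial_sums \<beta> \<subseteq> insert a ((+) a ` partial_sums \<alpha>)"
    using Cons.prems(6) by (auto simp: partial_sums_Cons split: if_splits)
  have shift: "d \<in> partial_sums \<alpha>" if "a + d \<in> partial_sums \<beta>" "0 < d" for d
    using sub that by auto
  have "a \<le> b"
  proof (cases "\<beta>' = []")
    case True
    then show ?thesis using Cons.prems(5) split by simp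
  next
    case False
    then have "b \<in> partial_sums \<beta>" using split by (simp add: partial_sums_Cons)
    then show ?thesis using sub by auto
  qed
  then consider "b = a" | c where "b = a + c" "0 < c"
    by (metis add.right_neutral le_iff_add neq0_conv)
  then show ?case
  proof cases
    case 1
    have "partial_sums \<beta>' \<subseteq> partial_sums \<alpha>"
    proof
      fix d assume d: "d \<in> partial_sums \<beta>'"
      then have "a + d \<in> partial_sums \<beta>"
        using split 1 by (cases "\<beta>' = []") (simp_all add: partial_sums_Cons)
      then show "d \<in> partial_sums \<alpha>"
        using shift partial_sums_pos[OF \<beta>'(2) d] by blast
    qed
    moreover have "length js' = length \<beta>'" "sorted_wrt (<) js'" "sum_list \<beta>' = sum_list \<alpha>"
      using Cons.prems(3-5) split 1 by simp_all
    ultimately obtain "is" where "length is = length \<alpha>" "sorted is" "set is = set js'"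
        "exponents \<alpha> is = exponents \<beta>' js'"
      using Cons.IH[OF \<alpha> \<beta>'(2)] by metis
    then show ?thesis
      using Cons.prems(4) split 1 by (intro exI[of _ "j # is"]) auto
  next
    case 2
    have "partial_sums (c # \<beta>') \<subseteq> partial_sums \<alpha>"
    proof
      fix d assume d: "d \<in> partial_sums (c # \<beta>')"
      then have "0 < d" using partial_sums_pos[of "c # \<beta>'"] \<beta>' 2 by simp
      then show "d \<in> partial_sums \<alpha>"
        using shift d split(1) 2(1) partial_sums_merge by simp
    qed
    moreover have "c # \<beta>' \<in> Comp" "length js = length (c # \<beta>')"
        "sum_list (c # \<beta>') = sum_list \<alpha>"
      using \<beta>'(2) Cons.prems(3,5) split 2 by simp_all
    ultimately obtain "is" where "length is = length \<alpha>" "sorted is" "set is = set js"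
        "exponents \<alpha> is = exponents (c # \<beta>') js"
      using Cons.IH[OF \<alpha>] Cons.prems(4) by metis
    then show ?thesis
      using Cons.prems(4) split 2
      by (intro exI[of _ "j # is"]) (auto simp: single_add add.assoc less_imp_le)
  qed
qed

theorem proposition3p5:
  fixes q r :: "'a::{comm_ring, comm_monoid_mult}" and \<alpha> :: "nat list"
  assumes "r = q + 1" and "\<alpha> \<in> Comp"
  shows "((\<lambda>is. mps_const (r ^ card (set is)) *
              (\<Prod>j<length \<alpha>. mps_var (is ! j) ^ (\<alpha> ! j)))
          has_sum eta q \<alpha>) {is :: num list. length is = length \<alpha> \<and> sorted is}"
proof (rule has_sum_monomial_terms)
  let ?A = "{is :: num list. length is = length \<alpha> \<and> sorted is}"
  show "inj_on (exponents \<alpha>) ?A"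
    using assms(2) by (rule inj_on_exponents)
  show "mps_coeff (mps_const (r ^ card (set is)) *
      (\<Prod>j<length \<alpha>. mps_var (is ! j) ^ (\<alpha> ! j))) m =
      (if m = exponents \<alpha> is then r ^ card (set is) else 0)" if "is \<in> ?A" for "is" m
    using that by (simp add: mps_coeff_const_mult mps_coeff_monomial)
  show "mps_coeff (eta q \<alpha>) (exponents \<alpha> is) = r ^ card (set is)" if "is \<in> ?A" for "is"
  proof -
    have "length is = length \<alpha>" "sorted is" using that by simp_all
    then obtain \<beta> js where "length js = length \<beta>" "\<beta> \<in> Comp" "sorted_wrt (<) js"
        "exponents \<beta> js = exponents \<alpha> is"
      and \<beta>: "sum_list \<beta> = sum_list \<alpha>" "partial_sums \<beta> \<subseteq> partial_sums \<alpha>"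
      using merge_equal_indices[OF _ assms(2)] by metis
    then have "shape (exponents \<alpha> is) = \<beta>"
      using shape_exponents by metis
    then show ?thesis
      using \<beta> assms that by (simp add: mps_coeff_eta keys_exponents)
  qed
  show "mps_coeff (eta q \<alpha>) m = 0" if notin: "m \<notin> exponents \<alpha> ` ?A" for m
  proof (rule ccontr)
    assume "mps_coeff (eta q \<alpha>) m \<noteq> 0"
    then have "sum_list (shape m) = sum_list \<alpha>" "partial_sums (shape m) \<subseteq> partial_sums \<alpha>"
      by (auto simp: mps_coeff_eta split: if_splits)
    then obtain "is" where "is \<in> ?A" "exponents \<alpha> is = m"
      using split_strict_indices[OF assms(2) shape_in_Comp,
          of "sorted_list_of_set (Poly_Mapping.keys m)" m]
      by (auto simp: length_shape exponents_shape)
    then show False using notin by (metis imageI)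
  qed
qed

end
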